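(* Let $n$ be a positive integer with prime factorization \[ n=2^{a}3^{b}5^{c}\prod_{i=1}^{y}p_i^{v_i}\prod_{j=1}^{s}q_j^{w_j}, \] where each $p_i$ satisfies $3<p_i\equiv 1,3,7,9\pmod{20}$ and each $q_j\equiv 11,13,17,19\pmod{20}$. Define $\Lambda(n)=\prod_{i=1}^{y}(1+v_i)\prod_{j=1}^{s}\frac{1+(-1)^{w_j}}{2}$. Let $t_1$, $t_2$, $t_3$ be the number of prime factors of $n$, counted with multiplicity, that are congruent to $3,7\pmod{20}$, to $23,29,41,47\pmod{60}$, and to $7,29,41,43\pmod{60}$, respectively. Then \[ (1,0,45;n)=\begin{cases}\tfrac12\left(1+(-1)^{a+t_1}+(-1)^{a+c+t_2}+(-1)^{c+t_3}\right)\Lambda(n), & b=0,\\ (b-1)(1+(-1)^{a+t_1})\Lambda(n), & b>0,\end{cases} \] \[ (5,0,9;n)=\begin{cases}\tfrac12\left(1+(-1)^{a+t_1}-(-1)^{a+c+t_2}-(-1)^{c+t_3}\right)\Lambda(n), & b=0,\\ (b-1)(1+(-1)^{a+t_1})\Lambda(n), & b>0,\end{cases} \] \[ (7,4,7;n)=\begin{cases}\tfrac12\left(1-(-1)^{a+t_1}+(-1)^{a+c+t_2}-(-1)^{c+t_3}\right)\Lambda(n), & b=0,\\ (b-1)(1-(-1)^{a+t_1})\Lambda(n), & b>0,\end{cases} \] \[ (2,2,23;n)=\begin{cases}\tfrac12\left(1-(-1)^{a+t_1}-(-1)^{a+c+t_2}+(-1)^{c+t_3}\right)\Lambda(n), &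 b=0,\\ (b-1)(1-(-1)^{a+t_1})\Lambda(n), & b>0.\end{cases} \]
   Context: For a binary quadratic form $(a,b,c)$, i.e. $ax^2+bxy+cy^2$, the quantity $(a,b,c;n)$ denotes the number of pairs $(x,y)\in\mathbb{Z}^2$ with $ax^2+bxy+cy^2=n$. *)

theory Defs
  imports Complex_Main "HOL-Computational_Algebra.Primes"
begin

definition form_reps :: "int \<Rightarrow> int \<Rightarrow> int \<Rightarrow> nat \<Rightarrow> nat" where
  "form_reps a b c n =
     card {(x :: int, y :: int). a * x\<^sup>2 + b * x * y + c * y\<^sup>2 = int n}"

text \<open>
  For positive definite forms the set counted in \<^const>\<open>form_reps\<close> is finite, so its cardinality
  is never the default value 0 that \<^const>\<open>card\<close> assigns to infinite sets.
\<close>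

lemma finite_form_reps:
  fixes a b c :: int
  assumes "a > 0" "4 * a * c - b\<^sup>2 > 0"
  shows "finite {(x :: int, y :: int). a * x\<^sup>2 + b * x * y + c * y\<^sup>2 = int n}"
proof (rule finite_subset)
  have bound: "\<bar>z\<bar> \<le> k" if "d * z\<^sup>2 \<le> k" "d > 0" for d z k :: int
  proof -
    have "\<bar>z\<bar> * 1 \<le> \<bar>z\<bar> * \<bar>z\<bar>"
      by (cases "z = 0") (auto intro!: mult_left_mono simp del: abs_mult_self_eq mult_1_right)
    then have "\<bar>z\<bar> \<le> z\<^sup>2"
      by (simp add: power2_eq_square)
    also have "z\<^sup>2 \<le> d * z\<^sup>2"
      using that(2) by (simp add: mult_le_cancel_right1)
    finally show ?thesis
      using that(1) by simp
  qed
  show "{(x :: int, y :: int). a * x\<^sup>2 + b * x * y + c * y\<^sup>2 = int n}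
          \<subseteq> {-(4 * c * int n)..4 * c * int n} \<times> {-(4 * a * int n)..4 * a * int n}"
  proof clarify
    fix x y :: int
    assume eq: "a * x\<^sup>2 + b * x * y + c * y\<^sup>2 = int n"
    have "(2 * a * x + b * y)\<^sup>2 + (4 * a * c - b\<^sup>2) * y\<^sup>2 = 4 * a * int n"
      unfolding eq[symmetric] by (simp add: power2_eq_square algebra_simps)
    then have y: "(4 * a * c - b\<^sup>2) * y\<^sup>2 \<le> 4 * a * int n"
      using zero_le_power2[of "2 * a * x + b * y"] by linarith
    have "(2 * c * y + b * x)\<^sup>2 + (4 * a * c - b\<^sup>2) * x\<^sup>2 = 4 * c * int n"
      unfolding eq[symmetric] by (simp add: power2_eq_square algebra_simps)
    then have x: "(4 * a * c - b\<^sup>2) * x\<^sup>2 \<le> 4 * c * int n"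
      using zero_le_power2[of "2 * c * y + b * x"] by linarith
    show "x \<in> {-(4 * c * int n)..4 * c * int n} \<and> y \<in> {-(4 * a * int n)..4 * a * int n}"
      using bound[OF x assms(2)] bound[OF y assms(2)] by auto
  qed
qed simp

definition Lambda :: "nat \<Rightarrow> real" where
  "Lambda n =
     (\<Prod>p\<in>{p \<in> prime_factors n. 3 < p \<and> p mod 20 \<in> {1, 3, 7, 9}}. 1 + real (multiplicity p n)) *
     (\<Prod>q\<in>{q \<in> prime_factors n. q mod 20 \<in> {11, 13, 17, 19}}. (1 + (-1) ^ multiplicity q n) / 2)"

text \<open>
  Prime factors are counted with multiplicity. In particular, the prime 3 contributes to
  \<open>num_prime_factors_mod 20 {3, 7} n\<close>.
\<close>

definition num_prime_factors_mod :: "nat \<Rightarrow> nat set \<Rightarrow> nat \<Rightarrow> nat" where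
  "num_prime_factors_mod m R n = size {#p \<in># prime_factorization n. p mod m \<in> R#}"

end

theory Submission
  imports
    Defs
    "HOL-Number_Theory.Quadratic_Reciprocity"
    "HOL-Library.Discrete_Functions"
begin

text \<open>
  All four forms are counted through \<open>x\<^sup>2 + 5y\<^sup>2\<close>. The solutions of \<open>x\<^sup>2 + 5y\<^sup>2 = n\<close> with
  \<open>3\<close> dividing \<open>y\<close> (resp. \<open>x\<close>) are the representations of \<open>n\<close> by \<open>(1,0,45)\<close> (resp. \<open>(5,0,9)\<close>), and
  those of \<open>x\<^sup>2 + 5y\<^sup>2 = 2n\<close> are the representations of \<open>n\<close> by \<open>(2,2,23)\<close> (resp. \<open>(7,4,7)\<close>).
  If \<open>3\<close> does not divide \<open>n\<close>, its residue modulo \<open>3\<close> decides which divisibility condition holds, and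
  this residue is given by the sign \<open>(-1)^(a + c + t2)\<close> whenever \<open>\<Lambda>(n) \<noteq> 0\<close>. If \<open>3\<close> divides \<open>n\<close>, the
  conditions are equivalent and the count is that of \<open>n/9\<close>.

  Let \<open>R(N)\<close> be the number of solutions of \<open>x\<^sup>2 + 5y\<^sup>2 = N\<close>. Then \<open>R(4m) = R(5m) = R(m)\<close>. For a prime
  \<open>q\<close> modulo which \<open>-5\<close> is not a square, \<open>R(q\<^sup>2m) = R(m)\<close>, and \<open>R(qm) = 0\<close> if \<open>q\<close> does not divide
  \<open>m\<close>. For any other prime \<open>p\<close> besides \<open>2\<close> and \<open>5\<close>, Thue's lemma gives \<open>kp = u\<^sup>2 + 5v\<^sup>2\<close> with
  \<open>k = 1\<close> or \<open>k = 2\<close>, and \<open>R(pm) + R(m/p) = 2R(km)\<close>, where \<open>R(m/p) = 0\<close> if \<open>p\<close> does not divide \<open>m\<close>.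
  Hence, for \<open>\<epsilon> = 1\<close> and \<open>\<epsilon> = -1\<close>, the sum \<open>R(n) + \<epsilon>R(2n)\<close> is multiplicative in \<open>n\<close> up to its value
  \<open>2\<close> at \<open>n = 1\<close>, and the relations give its factors at prime powers.
\<close>

section \<open>The quadratic character of \<open>-5\<close>\<close>

lemma Legendre_eqI:
  fixes p :: nat
  assumes "2 < p" "[Legendre a p = s] (mod p)" "s \<in> {-1, 0, 1}"
  shows "Legendre a p = s"
proof (rule ccontr)
  assume "Legendre a p \<noteq> s"
  moreover have "int p dvd Legendre a p - s"
    using assms(2) by (simp add: cong_iff_dvd_diff)
  ultimately have "int p \<le> \<bar>Legendre a p - s\<bar>"
    using dvd_imp_le_int[of "Legendre a p - s" "int p"] by simp
  moreover have "Legendre a p \<in> {-1, 0, 1}"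
    by (simp add: Legendre_def)
  ultimately show False
    using assms(1,3) by auto
qed

lemma Legendre_mult:
  fixes p :: nat
  assumes "prime p" "2 < p"
  shows "Legendre (a * b) p = Legendre a p * Legendre b p"
proof (rule Legendre_eqI)
  note euler = euler_criterion[OF assms]
  have "[(a * b) ^ ((p - 1) div 2) = Legendre a p * Legendre b p] (mod p)"
    unfolding power_mult_distrib by (intro cong_mult euler[THEN cong_sym])
  with euler show "[Legendre (a * b) p = Legendre a p * Legendre b p] (mod p)"
    by (rule cong_trans)
qed (use assms in \<open>auto simp: Legendre_def\<close>)

lemma Legendre_minus_1:
  fixes p :: nat
  assumes "prime p" "2 < p"
  shows "Legendre (-1) p = (-1) ^ ((p - 1) div 2)"
  using assms(2) euler_criterion[OF assms, of "-1"]
  by (rule Legendre_eqI) (simp add: minus_one_power_iff)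

lemma square_mod_5: "(y :: int)\<^sup>2 mod 5 \<in> {0, 1, 4}"
proof -
  have "y mod 5 \<in> {0, 1, 2, 3, 4}" by auto
  then have "(y mod 5)\<^sup>2 mod 5 \<in> {0, 1, 4}" by auto
  then show ?thesis by (simp add: power_mod)
qed

lemma Legendre_mod_5: "Legendre a 5 = (if 5 dvd a then 0 else if a mod 5 \<in> {1, 4} then 1 else -1)"
proof -
  have "a mod 5 \<in> {0, 1, 4}" if "QuadRes 5 a"
    using that square_mod_5 unfolding QuadRes_def cong_def by metis
  moreover have "QuadRes 5 a" if "a mod 5 \<in> {1, 4}"
  proof -
    have "1\<^sup>2 mod 5 = a mod 5 \<or> 2\<^sup>2 mod 5 = a mod 5" using that by auto
    then show ?thesis unfolding QuadRes_def cong_def by metis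
  qed
  ultimately show ?thesis
    by (auto simp: Legendre_def cong_def dvd_eq_mod_eq_0)
qed

lemma odd_prime_Legendre_5:
  fixes p :: nat
  assumes "prime p" "2 < p" "p \<noteq> 5"
  shows "Legendre 5 p = (if p mod 5 \<in> {1, 4} then 1 else -1)"
proof -
  have "\<not> 5 dvd p"
    using assms primes_dvd_imp_eq[of 5 p] by auto
  then have "Legendre p 5 = (if p mod 5 \<in> {1, 4} then 1 else -1)"
    by (simp add: Legendre_mod_5 int_dvd_int_iff[of 5, simplified] zmod_int[of _ 5, simplified, symmetric])
  moreover have "Legendre p 5 * Legendre 5 p = 1"
    using Quadratic_Reciprocity[of p 5] assms by simp
  ultimately show ?thesis
    by (auto split: if_splits)
qed

lemma QuadRes_minus_5_iff:
  fixes p :: nat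
  assumes "prime p" "2 < p" "p \<noteq> 5"
  shows "QuadRes p (-5) \<longleftrightarrow> p mod 20 \<in> {1, 3, 7, 9}"
proof -
  have odd: "odd p" and "\<not> 5 dvd p" "\<not> p dvd 5"
    using assms primes_dvd_imp_eq[of 5 p] primes_dvd_imp_eq[of p 5] prime_odd_nat by auto
  have "Legendre (-5) p = (-1) ^ ((p - 1) div 2) * (if p mod 5 \<in> {1, 4} then 1 else -1)"
    using Legendre_mult[OF assms(1,2), of "-1" 5] assms
    by (simp add: Legendre_minus_1 odd_prime_Legendre_5)
  moreover have "QuadRes p (-5) \<longleftrightarrow> Legendre (-5) p = 1"
    using \<open>\<not> p dvd 5\<close> by (auto simp: Legendre_def cong_0_iff int_dvd_int_iff[of _ 5, simplified])
  moreover have "even ((p - 1) div 2) \<longleftrightarrow> p mod 4 = 1"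
    using odd by presburger
  ultimately have "QuadRes p (-5) \<longleftrightarrow> (p mod 4 = 1 \<longleftrightarrow> p mod 5 \<in> {1, 4})"
    by (simp add: minus_one_power_iff)
  moreover have "(p mod 4 = 1 \<longleftrightarrow> p mod 5 \<in> {1, 4}) \<longleftrightarrow> p mod 20 \<in> {1, 3, 7, 9}"
  proof -
    have residues: "\<forall>r\<in>{..<20 :: nat}. r mod 2 = 1 \<longrightarrow> r mod 5 \<noteq> 0 \<longrightarrow>
      (r mod 4 = 1 \<longleftrightarrow> r mod 5 \<in> {1, 4}) \<longleftrightarrow> r \<in> {1, 3, 7, 9}"
      by code_simp
    have "p mod 2 = 1" "p mod 5 \<noteq> 0"
      using odd \<open>\<not> 5 dvd p\<close> by (simp_all add: odd_iff_mod_2_eq_one dvd_eq_mod_eq_0)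
    then show ?thesis
      using bspec[OF residues, of "p mod 20"] by (simp add: mod_mod_cancel)
  qed
  ultimately show ?thesis
    by simp
qed

section \<open>Solutions of \<open>x\<^sup>2 + d y\<^sup>2 = N\<close>\<close>

definition norm_sols :: "int \<Rightarrow> int \<Rightarrow> (int \<times> int) set" where
  "norm_sols d N = {(x, y). x\<^sup>2 + d * y\<^sup>2 = N}"

lemma in_norm_sols [simp]: "(x, y) \<in> norm_sols d N \<longleftrightarrow> x\<^sup>2 + d * y\<^sup>2 = N"
  by (simp add: norm_sols_def)

lemma finite_norm_sols:
  assumes "d > 0"
  shows "finite (norm_sols d N)"
proof (cases "N < 0")
  case True
  have "x\<^sup>2 + d * y\<^sup>2 \<ge> 0" for x y :: int
    using assms by simp
  with True have "norm_sols d N = {}"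
    by (auto simp: norm_sols_def not_le[symmetric])
  then show ?thesis by simp
next
  case False
  then show ?thesis
    using finite_form_reps[of 1 d 0 "nat N"] assms by (simp add: norm_sols_def)
qed

lemma card_norm_sols_pos_iff:
  assumes "d > 0"
  shows "card (norm_sols d N) > 0 \<longleftrightarrow> (\<exists>x y. x\<^sup>2 + d * y\<^sup>2 = N)"
  using finite_norm_sols[OF assms, of N] by (auto simp: card_gt_0_iff norm_sols_def)

lemma card_norm_sols_common_divisor:
  assumes "q \<noteq> 0"
  shows "card {(x, y) \<in> norm_sols d N. q dvd x \<and> q dvd y} =
    (if q\<^sup>2 dvd N then card (norm_sols d (N div q\<^sup>2)) else 0)"
proof -
  let ?S = "{(x, y) \<in> norm_sols d N. q dvd x \<and> q dvd y}"
  have scale: "(q * x)\<^sup>2 + d * (q * y)\<^sup>2 = q\<^sup>2 * (x\<^sup>2 + d * y\<^sup>2)" for x y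
    by (simp add: power2_eq_square algebra_simps)
  show ?thesis
  proof (cases "q\<^sup>2 dvd N")
    case True
    then obtain m where m: "N = q\<^sup>2 * m" by (rule dvdE)
    have "bij_betw (\<lambda>(x, y). (q * x, q * y)) (norm_sols d m) ?S"
      using assms by (intro bij_betw_byWitness[where f' = "\<lambda>(x, y). (x div q, y div q)"])
        (auto simp: m scale elim!: dvdE)
    from bij_betw_same_card[OF this] show ?thesis
      using assms by (simp add: m)
  next
    case False
    then have "?S = {}"
      using scale by (auto elim!: dvdE)
    then show ?thesis
      using False by (simp only: card.empty if_False)
  qed
qed

lemma card_norm_sols_forced_divisor:
  assumes "q \<noteq> 0" and "\<And>x y. x\<^sup>2 + d * y\<^sup>2 = N \<Longrightarrow> q dvd x \<and> q dvd y"
  shows "card (norm_sols d N) = (if q\<^sup>2 dvd N then card (norm_sols d (N div q\<^sup>2)) else 0)"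
proof -
  have "norm_sols d N = {(x, y) \<in> norm_sols d N. q dvd x \<and> q dvd y}"
    using assms(2) by auto
  then show ?thesis
    using card_norm_sols_common_divisor[OF assms(1)] by simp
qed

lemma card_norm_sols_four_times:
  assumes "d mod 4 = 1"
  shows "card (norm_sols d (4 * m)) = card (norm_sols d m)"
proof -
  have "even x \<and> even y" if "x\<^sup>2 + d * y\<^sup>2 = 4 * m" for x y
  proof -
    have square_mod_4: "z\<^sup>2 mod 4 = of_bool (odd z)" for z :: int
    proof -
      have "z mod 4 \<in> {0, 1, 2, 3}" by auto
      then have "(z mod 4)\<^sup>2 mod 4 = of_bool (odd (z mod 4))" by auto
      then show ?thesis by (simp add: power_mod dvd_mod_iff)
    qed
    have "(x\<^sup>2 mod 4 + (d mod 4) * (y\<^sup>2 mod 4)) mod 4 = (x\<^sup>2 + d * y\<^sup>2) mod 4"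
      by (intro mod_add_cong mod_mult_cong) simp_all
    then show ?thesis
      unfolding that by (cases "even x"; cases "even y") (auto simp: square_mod_4 assms)
  qed
  then show ?thesis
    using card_norm_sols_forced_divisor[of 2 d "4 * m"] by simp
qed

lemma card_norm_sols_ramified:
  assumes "prime d"
  shows "card (norm_sols d (d * m)) = card (norm_sols d m)"
proof -
  have d: "d \<noteq> 0" using assms by auto
  have "bij_betw (\<lambda>(x, y). (d * y, x)) (norm_sols d m) (norm_sols d (d * m))"
  proof (rule bij_betw_byWitness[where f' = "\<lambda>(x, y). (y, x div d)"])
    show "(\<lambda>(x, y). (d * y, x)) ` norm_sols d m \<subseteq> norm_sols d (d * m)"
      by (auto simp: power2_eq_square algebra_simps)
    have "\<exists>z. x = d * z \<and> y\<^sup>2 + d * z\<^sup>2 = m" if "x\<^sup>2 + d * y\<^sup>2 = d * m" for x y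
    proof -
      have "x\<^sup>2 = d * (m - y\<^sup>2)"
        using that by (simp add: algebra_simps)
      then have "d dvd x"
        using prime_dvd_power[OF assms, of x 2] by simp
      then obtain z where z: "x = d * z" by (rule dvdE)
      have "d * (y\<^sup>2 + d * z\<^sup>2) = d * m"
        using that unfolding z by (simp add: power2_eq_square algebra_simps)
      with z d show ?thesis by simp
    qed
    then show "\<forall>z \<in> norm_sols d (d * m). (\<lambda>(x, y). (d * y, x)) ((\<lambda>(x, y). (y, x div d)) z) = z"
      "(\<lambda>(x, y). (y, x div d)) ` norm_sols d (d * m) \<subseteq> norm_sols d m"
      using d by fastforce+
  qed (use d in auto)
  from bij_betw_same_card[OF this] show ?thesis ..
qed

lemma nonresidue_prime_dvd_norm:
  fixes q :: int
  assumes q: "prime q" and nonres: "\<not> QuadRes q (- d)" and dvd: "q dvd x\<^sup>2 + d * y\<^sup>2"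
  shows "q dvd x \<and> q dvd y"
proof -
  have y: "q dvd y"
  proof (rule ccontr)
    assume "\<not> q dvd y"
    then have "coprime y q"
      using prime_imp_coprime[OF q] by (blast intro: coprime_commute[THEN iffD1])
    then obtain w where "[y * w = 1] (mod q)"
      using cong_solve_coprime_int by blast
    then have "q dvd y * w - 1" by (simp add: cong_iff_dvd_diff)
    moreover have "(x * w)\<^sup>2 - (- d) = w\<^sup>2 * (x\<^sup>2 + d * y\<^sup>2) - d * (y * w + 1) * (y * w - 1)"
      by (simp add: power2_eq_square algebra_simps)
    ultimately have "q dvd (x * w)\<^sup>2 - (- d)"
      using dvd by (metis dvd_diff dvd_mult)
    then show False
      using nonres by (auto simp: QuadRes_def cong_iff_dvd_diff)
  qed
  then have "q dvd d * y\<^sup>2" by (simp add: power2_eq_square)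
  with dvd have "q dvd x\<^sup>2" by (metis dvd_add_left_iff)
  with y show ?thesis using prime_dvd_power[OF q] by blast
qed

lemma card_norm_sols_inert_power:
  fixes q :: int
  assumes q: "prime q" and nonres: "\<not> QuadRes q (- d)" and m: "\<not> q dvd m"
  shows "card (norm_sols d (q ^ v * m)) = (if even v then card (norm_sols d m) else 0)"
proof (induction v rule: less_induct)
  case (less v)
  have q0: "q \<noteq> 0" using q by auto
  have forced: "card (norm_sols d N) = (if q\<^sup>2 dvd N then card (norm_sols d (N div q\<^sup>2)) else 0)"
    if "q dvd N" for N
    using card_norm_sols_forced_divisor[OF q0] nonresidue_prime_dvd_norm[OF q nonres] that by metis
  consider (zero) "v = 0" | (one) "v = 1" | (step) w where "v = w + 2"
    by (metis One_nat_def add_2_eq_Suc' not0_implies_Suc)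
  then show ?case
  proof cases
    case zero
    then show ?thesis by simp
  next
    case one
    have "\<not> q\<^sup>2 dvd q * m"
      using m q0 by (simp add: power2_eq_square)
    then show ?thesis
      using forced[of "q * m"] one by simp
  next
    case step
    then have eq: "q ^ v * m = q\<^sup>2 * (q ^ w * m)"
      by (simp add: power_add power2_eq_square)
    have "card (norm_sols d (q ^ v * m)) = card (norm_sols d (q ^ w * m))"
      unfolding eq using forced[of "q\<^sup>2 * (q ^ w * m)"] q0 by simp
    then show ?thesis
      using less.IH[of w] step by simp
  qed
qed

lemma conjugate_quotient:
  fixes d u v a b m x y s t :: int
  assumes ab: "u\<^sup>2 + d * v\<^sup>2 = a * b" "a \<noteq> 0" and norm: "x\<^sup>2 + d * y\<^sup>2 = a * m"
    and s: "x * u + d * y * v = a * s" and t: "y * u - x * v = a * t"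
  shows "s * u - d * t * v = b * x" "t * u + s * v = b * y" "s\<^sup>2 + d * t\<^sup>2 = b * m"
proof -
  have "a * (s * u - d * t * v) = (a * s) * u - d * (a * t) * v"
    by (simp add: algebra_simps)
  also have "\<dots> = (u\<^sup>2 + d * v\<^sup>2) * x"
    unfolding s[symmetric] t[symmetric] by (simp add: power2_eq_square algebra_simps)
  finally show "s * u - d * t * v = b * x"
    using ab by simp
  have "a * (t * u + s * v) = (a * t) * u + (a * s) * v"
    by (simp add: algebra_simps)
  also have "\<dots> = (u\<^sup>2 + d * v\<^sup>2) * y"
    unfolding s[symmetric] t[symmetric] by (simp add: power2_eq_square algebra_simps)
  finally show "t * u + s * v = b * y"
    using ab by simp
  have "a * (a * (s\<^sup>2 + d * t\<^sup>2)) = (a * s)\<^sup>2 + d * (a * t)\<^sup>2"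
    by (simp add: power2_eq_square algebra_simps)
  also have "\<dots> = (x\<^sup>2 + d * y\<^sup>2) * (u\<^sup>2 + d * v\<^sup>2)"
    unfolding s[symmetric] t[symmetric] by (simp add: power2_eq_square algebra_simps)
  also have "\<dots> = a * (a * (b * m))"
    by (simp add: norm ab(1))
  finally show "s\<^sup>2 + d * t\<^sup>2 = b * m"
    using ab by simp
qed

text \<open>
  Writing \<open>\<alpha> = x + y \<surd>-d\<close> and \<open>\<pi> = u + v \<surd>-d\<close>, with conjugate \<open>\<pi>'\<close>, the bijection is
  \<open>\<alpha> \<mapsto> \<alpha> \<pi>' / a\<close>, with inverse \<open>\<alpha> \<mapsto> \<alpha> \<pi> / b\<close>.
\<close>

lemma card_norm_sols_conjugate_multiples:
  fixes d u v a b m :: int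
  assumes "u\<^sup>2 + d * v\<^sup>2 = a * b" "a \<noteq> 0" "b \<noteq> 0"
  shows "card {(x, y) \<in> norm_sols d (a * m). a dvd x * u + d * y * v \<and> a dvd y * u - x * v} =
    card {(x, y) \<in> norm_sols d (b * m). b dvd x * u - d * y * v \<and> b dvd y * u + x * v}"
proof -
  let ?S = "\<lambda>a v. {(x, y) \<in> norm_sols d (a * m). a dvd x * u + d * y * v \<and> a dvd y * u - x * v}"
  let ?f = "\<lambda>a v (x, y). ((x * u + d * y * v) div a, (y * u - x * v) div a)"
  have inverse: "?f a v z \<in> ?S b (- v) \<and> ?f b (- v) (?f a v z) = z"
    if ab: "u\<^sup>2 + d * v\<^sup>2 = a * b" "a \<noteq> 0" "b \<noteq> 0" and z: "z \<in> ?S a v" for a b v z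
  proof -
    obtain x y where xy: "z = (x, y)" by fastforce
    with z obtain s t where s: "x * u + d * y * v = a * s" and t: "y * u - x * v = a * t"
      by (auto elim!: dvdE)
    have "x\<^sup>2 + d * y\<^sup>2 = a * m"
      using z by (simp add: xy)
    then show ?thesis
      using conjugate_quotient[OF ab(1,2) _ s t] ab(2,3) by (simp add: xy s t)
  qed
  have "bij_betw (?f a v) (?S a v) (?S b (- v))"
  proof (rule bij_betw_byWitness[where f' = "?f b (- v)"])
    have "u\<^sup>2 + d * (- v)\<^sup>2 = b * a"
      using assms(1) by simp
    note forward = inverse[OF assms]
      and backward = inverse[OF this assms(3,2), unfolded minus_minus]
    show "\<forall>z \<in> ?S a v. ?f b (- v) (?f a v z) = z" by (intro ballI conjunct2[OF forward])
    show "\<forall>z \<in> ?S b (- v). ?f a v (?f b (- v) z) = z" by (intro ballI conjunct2[OF backward])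
    show "?f a v ` ?S a v \<subseteq> ?S b (- v)" by (intro image_subsetI conjunct1[OF forward])
    show "?f b (- v) ` ?S b (- v) \<subseteq> ?S a v" by (intro image_subsetI conjunct1[OF backward])
  qed
  from bij_betw_same_card[OF this] show ?thesis by simp
qed

lemma card_norm_sols_prime_multiples:
  fixes p :: int
  assumes p: "prime p" and uv: "u\<^sup>2 + d * v\<^sup>2 = k * p" and k: "k = 1 \<or> k = 2 \<and> odd d"
  shows "card {(x, y) \<in> norm_sols d (p * m). p dvd y * u - x * v} = card (norm_sols d (k * m))"
proof -
  have "p dvd x * u + d * y * v" if "x\<^sup>2 + d * y\<^sup>2 = p * m" "p dvd y * u - x * v" for x y
  proof -
    have "(x * u + d * y * v)\<^sup>2 = (x\<^sup>2 + d * y\<^sup>2) * (u\<^sup>2 + d * v\<^sup>2) - d * (y * u - x * v)\<^sup>2"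
      by (simp add: power2_eq_square algebra_simps)
    also have "p dvd \<dots>"
      using that by (auto simp: power2_eq_square)
    finally show ?thesis
      using prime_dvd_power[OF p] by blast
  qed
  then have "{(x, y) \<in> norm_sols d (p * m). p dvd y * u - x * v} =
    {(x, y) \<in> norm_sols d (p * m). p dvd x * u + d * y * v \<and> p dvd y * u - x * v}"
    by auto
  moreover have "k dvd x * u - d * y * v \<and> k dvd y * u + x * v" if "x\<^sup>2 + d * y\<^sup>2 = k * m" for x y
  proof (cases "k = 1")
    case False
    then have "k = 2" "odd d" using k by auto
    moreover have "even (x\<^sup>2 + d * y\<^sup>2)" "even (u\<^sup>2 + d * v\<^sup>2)"
      unfolding that uv \<open>k = 2\<close> by simp_all
    ultimately show ?thesis by auto
  qed simp
  then have "norm_sols d (k * m) =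
    {(x, y) \<in> norm_sols d (k * m). k dvd x * u - d * y * v \<and> k dvd y * u + x * v}"
    by auto
  moreover have "p \<noteq> 0" "k \<noteq> 0" "u\<^sup>2 + d * v\<^sup>2 = p * k"
    using p k uv by auto
  ultimately show ?thesis
    using card_norm_sols_conjugate_multiples[of u d v p k m] by simp
qed

lemma prime_not_dvd_norm_coordinate:
  fixes p :: int
  assumes p: "prime p" "\<not> p dvd d" "\<not> p dvd k" and uv: "u\<^sup>2 + d * v\<^sup>2 = k * p"
  shows "\<not> p dvd u"
proof
  assume u: "p dvd u"
  then have "p dvd k * p - u\<^sup>2"
    by (simp add: power2_eq_square)
  also have "k * p - u\<^sup>2 = d * v\<^sup>2"
    using uv by simp
  finally have "p dvd v"
    using p prime_dvd_mult_iff prime_dvd_power by blast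
  with u have "p * p dvd u\<^sup>2 + d * v\<^sup>2"
    by (intro dvd_add dvd_mult) (simp_all add: power2_eq_square mult_dvd_mono)
  then have "p dvd k"
    unfolding uv using p(1) by (auto simp: mult.commute)
  with p(3) show False ..
qed

lemma prime_dvd_conjugate_coordinate:
  fixes p :: int
  assumes "prime p" "u\<^sup>2 + d * v\<^sup>2 = k * p" "x\<^sup>2 + d * y\<^sup>2 = p * m"
  shows "p dvd y * u - x * v \<or> p dvd y * u + x * v"
proof -
  have "(y * u - x * v) * (y * u + x * v) = y\<^sup>2 * (u\<^sup>2 + d * v\<^sup>2) - v\<^sup>2 * (x\<^sup>2 + d * y\<^sup>2)"
    by (simp add: power2_eq_square algebra_simps)
  also have "p dvd \<dots>"
    unfolding assms(2,3) by simp
  finally show ?thesis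
    by (simp only: prime_dvd_mult_iff[OF assms(1)])
qed

lemma prime_dvd_both_conjugate_coordinates:
  fixes p :: int
  assumes p: "prime p" "\<not> p dvd 2" "\<not> p dvd u" and norm: "x\<^sup>2 + d * y\<^sup>2 = p * m"
    and dvd: "p dvd y * u - x * v" "p dvd y * u + x * v"
  shows "p dvd x \<and> p dvd y"
proof -
  have "(y * u - x * v) + (y * u + x * v) = 2 * (y * u)"
    by simp
  with dvd_add[OF dvd] have "p dvd 2 * (y * u)"
    by (simp only:)
  then have y: "p dvd y"
    using p by (simp add: prime_dvd_mult_iff)
  then have "p dvd p * m - d * y\<^sup>2"
    by (simp add: power2_eq_square)
  also have "p * m - d * y\<^sup>2 = x\<^sup>2"
    using norm by simp
  finally show ?thesis
    using y prime_dvd_power[OF p(1)] by blast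
qed

lemma card_norm_sols_split_prime:
  fixes p :: int
  assumes p: "prime p" "odd p" "\<not> p dvd d" and "d > 0"
    and uv: "u\<^sup>2 + d * v\<^sup>2 = k * p" and k: "k = 1 \<or> k = 2 \<and> odd d"
  shows "card (norm_sols d (p * m)) + (if p dvd m then card (norm_sols d (m div p)) else 0) =
    2 * card (norm_sols d (k * m))"
proof -
  let ?A = "{(x, y) \<in> norm_sols d (p * m). p dvd y * u - x * v}"
  let ?B = "{(x, y) \<in> norm_sols d (p * m). p dvd y * u + x * v}"
  have p_not_dvd_2: "\<not> p dvd 2"
    using p(1,2) primes_dvd_imp_eq[of p 2] by auto
  have p_not_dvd_u: "\<not> p dvd u"
    using prime_not_dvd_norm_coordinate[OF p(1,3) _ uv] p(1) p_not_dvd_2 k by auto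
  have union_eq: "?A \<union> ?B = norm_sols d (p * m)"
    using prime_dvd_conjugate_coordinate[OF p(1) uv] unfolding norm_sols_def by blast
  have "?A \<inter> ?B = {(x, y) \<in> norm_sols d (p * m). p dvd x \<and> p dvd y}"
    using prime_dvd_both_conjugate_coordinates[OF p(1) p_not_dvd_2 p_not_dvd_u, where d = d and m = m and v = v] by auto
  then have card_inter: "card (?A \<inter> ?B) = (if p dvd m then card (norm_sols d (m div p)) else 0)"
    using card_norm_sols_common_divisor[of p d "p * m"] p(1) by (auto simp: power2_eq_square)
  have "card ?A = card (norm_sols d (k * m))"
    using card_norm_sols_prime_multiples[OF p(1) uv k] .
  moreover have "card ?B = card (norm_sols d (k * m))"
    using card_norm_sols_prime_multiples[OF p(1) _ k, of u "- v" m] uv by simp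
  moreover have "finite ?A" "finite ?B"
    using finite_norm_sols[OF \<open>d > 0\<close>, of "p * m"] by (auto elim: rev_finite_subset)
  ultimately show ?thesis
    using card_Un_Int[of ?A ?B] by (simp only: union_eq card_inter mult_2)
qed

section \<open>Primes and doubles of primes of the form \<open>x\<^sup>2 + 5 y\<^sup>2\<close>\<close>

lemma thue:
  fixes m :: nat and r :: int
  assumes "m > 0" and nonsquare: "\<And>s. s\<^sup>2 \<noteq> m"
  obtains x y :: int where "int m dvd x - r * y" "x\<^sup>2 < m" "y\<^sup>2 < m" "(x, y) \<noteq> (0, 0)"
proof -
  define s where "s = floor_sqrt m"
  have m_less: "m < (s + 1)\<^sup>2" and "s\<^sup>2 \<le> m"
    unfolding s_def using Suc_floor_sqrt_power2_gt[of m] by simp_all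
  then have "s\<^sup>2 < m"
    using nonsquare[of s] by simp
  then have less_m: "z\<^sup>2 < int m" if "\<bar>z\<bar> \<le> int s" for z
    using power_mono[OF that abs_ge_zero, of 2] by (simp flip: of_nat_power)
  define f where "f = (\<lambda>(i, j). (i - r * j) mod int m)"
  let ?A = "{0..int s} \<times> {0..int s}"
  have "f ` ?A \<subseteq> {0..<int m}"
    using \<open>m > 0\<close> by (auto simp: f_def)
  then have "card (f ` ?A) \<le> m"
    using card_mono[of "{0..<int m}" "f ` ?A"] by simp
  also have "m < card ?A"
    using m_less by (simp add: power2_eq_square nat_add_distrib)
  finally have "\<not> inj_on f ?A"
    by (rule pigeonhole)
  then obtain i j i' j' where bounds: "i \<in> {0..int s}" "j \<in> {0..int s}" "i' \<in> {0..int s}" "j' \<in> {0..int s}"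
    and collision: "f (i, j) = f (i', j')" "(i, j) \<noteq> (i', j')"
    unfolding inj_on_def by auto
  have "int m dvd (i - r * j) - (i' - r * j')"
    using collision(1) by (simp add: f_def mod_eq_dvd_iff)
  then have "int m dvd (i - i') - r * (j - j')"
    by (simp add: algebra_simps)
  then show ?thesis
    using bounds collision(2) by (intro that[of "i - i'" "j - j'"] less_m) auto
qed

lemma residue_prime_small_multiple:
  fixes p :: nat
  assumes p: "prime p" and residue: "QuadRes p (- d)" and d: "d > 0"
  obtains k u v :: int where "0 < k" "k \<le> d" "u\<^sup>2 + d * v\<^sup>2 = k * p"
proof -
  obtain r where r: "int p dvd r\<^sup>2 + d"
    using residue by (auto simp: QuadRes_def cong_iff_dvd_diff)
  have "s\<^sup>2 \<noteq> p" for s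
    using p prime_power_iff[of s 2] by auto
  then obtain x y where dvd: "int p dvd x - r * y" and less: "x\<^sup>2 < p" "y\<^sup>2 < p" and "(x, y) \<noteq> (0, 0)"
    using thue[of p r] prime_gt_0_nat[OF p] by blast
  have "x\<^sup>2 + d * y\<^sup>2 = (x - r * y) * (x + r * y) + (r\<^sup>2 + d) * y\<^sup>2"
    by (simp add: power2_eq_square algebra_simps)
  also have "int p dvd \<dots>"
    using dvd r by simp
  finally obtain k where "x\<^sup>2 + d * y\<^sup>2 = int p * k"
    by (rule dvdE)
  then have k: "x\<^sup>2 + d * y\<^sup>2 = k * p"
    by (simp add: mult.commute)
  have "0 < x\<^sup>2 + d * y\<^sup>2"
    using \<open>(x, y) \<noteq> (0, 0)\<close> d by (cases "x = 0") (auto intro: add_pos_nonneg)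
  moreover have "x\<^sup>2 + d * y\<^sup>2 < p + d * p"
    using less d by (intro add_strict_mono mult_strict_left_mono)
  then have "k * p < (d + 1) * p"
    unfolding k by (simp add: algebra_simps)
  ultimately have "0 < k" "k < d + 1"
    using prime_gt_0_nat[OF p] unfolding k by (auto simp: zero_less_mult_iff)
  then show ?thesis
    using that k by simp
qed

lemma residue_prime_norm_5:
  fixes p :: nat
  assumes "prime p" "QuadRes p (-5)"
  obtains k u v :: int where "k = 1 \<or> k = 2" "u\<^sup>2 + 5 * v\<^sup>2 = k * p"
proof -
  obtain k u v :: int where "0 < k" "k \<le> 5" and uv: "u\<^sup>2 + 5 * v\<^sup>2 = k * p"
    using residue_prime_small_multiple[OF assms zero_less_numeral] .
  then consider (small) "k = 1 \<or> k = 2" | (three) "k = 3" | (four) "k = 4" | (five) "k = 5"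
    by fastforce
  then show ?thesis
  proof cases
    case small
    then show ?thesis using uv by (rule that)
  next
    case three
    have "(u + v) * (u - v) = 3 * (p - 2 * v\<^sup>2)"
      using uv three by (simp add: power2_eq_square algebra_simps)
    then have "3 dvd u + v \<or> 3 dvd u - v"
      using prime_dvd_mult_iff[of "3 :: int" "u + v" "u - v"] by simp
    then obtain w where w: "3 dvd u + w" "w\<^sup>2 = v\<^sup>2"
      using that[of v] that[of "- v"] by auto
    then obtain t where u: "u = 3 * t - w"
      by (metis dvdE add_diff_cancel_right')
    have "u\<^sup>2 + 5 * w\<^sup>2 = 3 * p"
      using uv three w(2) by simp
    then have "(t - 2 * w)\<^sup>2 + 5 * t\<^sup>2 = 2 * p"
      unfolding u by (simp add: power2_eq_square algebra_simps)
    then show ?thesis by (intro that) simp_all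
  next
    case four
    then have "card (norm_sols 5 (4 * p)) > 0"
      using uv by (auto simp: card_norm_sols_pos_iff)
    then obtain a b where "a\<^sup>2 + 5 * b\<^sup>2 = int p"
      by (auto simp: card_norm_sols_four_times card_norm_sols_pos_iff)
    then show ?thesis using that[of 1 a b] by simp
  next
    case five
    then have "card (norm_sols 5 (5 * p)) > 0"
      using uv by (auto simp: card_norm_sols_pos_iff)
    then obtain a b where "a\<^sup>2 + 5 * b\<^sup>2 = int p"
      by (auto simp: card_norm_sols_ramified card_norm_sols_pos_iff)
    then show ?thesis using that[of 1 a b] by simp
  qed
qed

definition nonprincipal_prime :: "nat \<Rightarrow> bool" where
  "nonprincipal_prime p \<longleftrightarrow> p = 2 \<or> p mod 20 \<in> {3, 7}"

lemma split_prime_norm_5: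
  fixes p :: nat
  assumes "prime p" "p \<noteq> 2" "p mod 20 \<in> {1, 3, 7, 9}"
  obtains u v :: int where "u\<^sup>2 + 5 * v\<^sup>2 = (if nonprincipal_prime p then 2 else 1) * int p"
proof -
  have "2 < p" "p \<noteq> 5"
    using assms prime_gt_1_nat[of p] by auto
  then obtain k u v :: int where k: "k = 1 \<or> k = 2" and uv: "u\<^sup>2 + 5 * v\<^sup>2 = k * p"
    using residue_prime_norm_5[OF assms(1)] QuadRes_minus_5_iff[OF assms(1)] assms(3) by blast
  have "k * p mod 5 = u\<^sup>2 mod 5"
    unfolding uv[symmetric] by simp
  then have "k * (p mod 5) mod 5 \<in> {0, 1, 4}"
    using square_mod_5[of u] by (simp add: zmod_int mod_mult_right_eq)
  moreover have "p mod 5 = p mod 20 mod 5"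
    by (simp add: mod_mod_cancel)
  ultimately have "k = (if nonprincipal_prime p then 2 else 1)"
    using k assms(2,3) by (auto simp: nonprincipal_prime_def)
  with uv that show ?thesis by blast
qed

section \<open>Signs and \<open>\<Lambda>\<close> at prime powers\<close>

lemma prime_power_coprime_induct [consumes 1, case_names one prime_power_times]:
  fixes n :: nat
  assumes "n > 0" and "P 1"
    and "\<And>p v m. \<lbrakk>prime p; \<not> p dvd m; P m\<rbrakk> \<Longrightarrow> P (p ^ v * m)"
  shows "P n"
  using assms(1)
proof (induction n rule: less_induct)
  case (less n)
  show ?case
  proof (cases "n = 1")
    case True
    then show ?thesis using assms(2) by simp
  next
    case False
    then obtain p where p: "prime p" "p dvd n"
      using prime_factor_nat by blast
    obtain m where m: "n = p ^ multiplicity p n * m" "\<not> p dvd m"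
      using less.prems p(1) by (metis multiplicity_decompose' not_prime_unit less_not_refl)
    have "m > 0"
      using m(2) by (intro gr0I) auto
    moreover have "1 < p ^ multiplicity p n"
      using p less.prems by (intro one_less_power) (auto simp: prime_gt_Suc_0_nat prime_multiplicity_gt_zero_iff)
    ultimately have "m < n"
      using m(1) by (metis One_nat_def n_less_m_mult_n)
    then show ?thesis
      using assms(3)[OF p(1) m(2)] less.IH \<open>m > 0\<close> m(1) by metis
  qed
qed

lemma multiplicity_prime_power_times:
  fixes p q m :: nat
  assumes "prime p" "prime q" "m > 0"
  shows "multiplicity q (p ^ v * m) = v * of_bool (p = q) + multiplicity q m"
  using assms
  by (simp add: prime_elem_multiplicity_mult_distrib multiplicity_distinct_prime_power)

definition prime_factor_count :: "(nat \<Rightarrow> bool) \<Rightarrow> nat \<Rightarrow> nat" where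
  "prime_factor_count P n = size {#p \<in># prime_factorization n. P p#}"

lemma multiplicity_eq_prime_factor_count:
  assumes "prime q"
  shows "multiplicity q n = prime_factor_count (\<lambda>p. p = q) n"
  using assms by (simp add: prime_factor_count_def filter_eq_replicate_mset count_prime_factorization)

lemma num_prime_factors_mod_eq_prime_factor_count:
  "num_prime_factors_mod d R n = prime_factor_count (\<lambda>p. p mod d \<in> R) n"
  by (simp add: num_prime_factors_mod_def prime_factor_count_def)

lemma prime_factor_count_prime_power_times:
  assumes "prime p" "m > 0"
  shows "prime_factor_count P (p ^ v * m) = v * of_bool (P p) + prime_factor_count P m"
proof -
  have "size (filter_mset P (replicate_mset v p)) = v * of_bool (P p)"
    by (induction v) simp_all
  then show ?thesis
    using assms
    by (simp add: prime_factor_count_def prime_factorization_mult prime_factorization_prime_power)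
qed

lemma prime_factor_count_cong:
  assumes "\<And>p. prime p \<Longrightarrow> p dvd n \<Longrightarrow> P p \<longleftrightarrow> Q p"
  shows "prime_factor_count P n = prime_factor_count Q n"
  unfolding prime_factor_count_def
  using assms by (intro arg_cong[of _ _ size] filter_mset_cong) auto

lemma minus_one_power_prime_factor_count_add:
  "(-1 :: 'a :: comm_ring_1) ^ (prime_factor_count P n + prime_factor_count Q n) =
    (-1) ^ prime_factor_count (\<lambda>p. P p \<noteq> Q p) n"
proof -
  have "even (size {#p \<in># M. P p#} + size {#p \<in># M. Q p#}) \<longleftrightarrow> even (size {#p \<in># M. P p \<noteq> Q p#})"
    for M :: "nat multiset"
    by (induction M) auto
  then show ?thesis
    by (simp add: prime_factor_count_def minus_one_power_iff)
qed

definition residues_coprime_60 :: "nat set" where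
  "residues_coprime_60 = {1, 7, 11, 13, 17, 19, 23, 29, 31, 37, 41, 43, 47, 49, 53, 59}"

lemma prime_mod_60:
  fixes p :: nat
  assumes "prime p" "p \<notin> {2, 3, 5}"
  shows "p mod 60 \<in> residues_coprime_60"
proof -
  have residues: "\<forall>r\<in>{..<60 :: nat}. r mod 2 \<noteq> 0 \<longrightarrow> r mod 3 \<noteq> 0 \<longrightarrow> r mod 5 \<noteq> 0 \<longrightarrow>
    r \<in> residues_coprime_60"
    by code_simp
  have "\<not> 2 dvd p" "\<not> 3 dvd p" "\<not> 5 dvd p"
    using assms primes_dvd_imp_eq[of 2 p] primes_dvd_imp_eq[of 3 p] primes_dvd_imp_eq[of 5 p]
    by auto
  then have "p mod 2 \<noteq> 0" "p mod 3 \<noteq> 0" "p mod 5 \<noteq> 0"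
    by (simp_all add: dvd_eq_mod_eq_0)
  then show ?thesis
    using bspec[OF residues, of "p mod 60"] by (simp add: mod_mod_cancel)
qed

text \<open>
  Inert primes congruent to \<open>2\<close> modulo \<open>3\<close> are left out: they have even multiplicity in \<open>n\<close> whenever
  \<open>\<Lambda>(n) \<noteq> 0\<close>.
\<close>

definition mod_3_nonresidue_prime :: "nat \<Rightarrow> bool" where
  "mod_3_nonresidue_prime p \<longleftrightarrow> p = 2 \<or> p = 5 \<or> p mod 60 \<in> {23, 29, 41, 47}"

definition class_sign :: "nat \<Rightarrow> real" where
  "class_sign n = (-1) ^ prime_factor_count nonprincipal_prime n"

definition mod_3_sign :: "nat \<Rightarrow> real" where
  "mod_3_sign n = (-1) ^ prime_factor_count mod_3_nonresidue_prime n"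

lemma minus_one_power_eq_class_sign:
  "(-1) ^ (multiplicity 2 n + num_prime_factors_mod 20 {3, 7} n) = class_sign n"
proof -
  have "prime_factor_count (\<lambda>p. (p = 2) \<noteq> (p mod 20 \<in> {3, 7})) n =
    prime_factor_count nonprincipal_prime n"
    by (intro prime_factor_count_cong) (auto simp: nonprincipal_prime_def)
  then show ?thesis
    by (simp only: class_sign_def multiplicity_eq_prime_factor_count two_is_prime_nat
        num_prime_factors_mod_eq_prime_factor_count minus_one_power_prime_factor_count_add)
qed

lemma minus_one_power_eq_mod_3_sign:
  "(-1) ^ (multiplicity 2 n + multiplicity 5 n + num_prime_factors_mod 60 {23, 29, 41, 47} n) =
    mod_3_sign n"
proof -
  have "prime (5 :: nat)" by simp
  have "(-1 :: real) ^ (multiplicity 2 n + multiplicity 5 n +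
      num_prime_factors_mod 60 {23, 29, 41, 47} n) =
    (-1) ^ prime_factor_count (\<lambda>p. ((p = 2) \<noteq> (p = 5)) \<noteq> (p mod 60 \<in> {23, 29, 41, 47})) n"
    by (simp only: power_add[of _ "_ + _"] multiplicity_eq_prime_factor_count two_is_prime_nat
        \<open>prime 5\<close> num_prime_factors_mod_eq_prime_factor_count
        minus_one_power_prime_factor_count_add flip: power_add)
  also have "prime_factor_count
      (\<lambda>p. ((p = 2) \<noteq> (p = 5)) \<noteq> (p mod 60 \<in> {23, 29, 41, 47})) n =
    prime_factor_count mod_3_nonresidue_prime n"
    by (intro prime_factor_count_cong) (auto simp: mod_3_nonresidue_prime_def)
  finally show ?thesis
    by (simp only: mod_3_sign_def)
qed

lemma minus_one_power_eq_class_sign_times_mod_3_sign: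
  assumes "\<not> 3 dvd n"
  shows "(-1) ^ (multiplicity 5 n + num_prime_factors_mod 60 {7, 29, 41, 43} n) =
    class_sign n * mod_3_sign n"
proof -
  have "prime_factor_count (\<lambda>p. (p = 5) \<noteq> (p mod 60 \<in> {7, 29, 41, 43})) n =
    prime_factor_count (\<lambda>p. nonprincipal_prime p \<noteq> mod_3_nonresidue_prime p) n"
  proof (rule prime_factor_count_cong)
    fix p :: nat assume "prime p" "p dvd n"
    then consider (two) "p = 2" | (five) "p = 5" | (coprime) "p \<notin> {2, 3, 5}"
      using assms by auto
    then show "((p = 5) \<noteq> (p mod 60 \<in> {7, 29, 41, 43})) \<longleftrightarrow>
      (nonprincipal_prime p \<noteq> mod_3_nonresidue_prime p)"
    proof cases
      case coprime
      have "\<forall>r\<in>residues_coprime_60.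
        (r \<in> {7, 29, 41, 43}) = ((r mod 20 \<in> {3, 7}) \<noteq> (r \<in> {23, 29, 41, 47}))"
        by (simp add: residues_coprime_60_def)
      from bspec[OF this prime_mod_60[OF \<open>prime p\<close> coprime]]
      show ?thesis
        using coprime by (simp add: nonprincipal_prime_def mod_3_nonresidue_prime_def mod_mod_cancel)
    qed (simp_all add: nonprincipal_prime_def mod_3_nonresidue_prime_def)
  qed
  moreover have "prime (5 :: nat)" by simp
  ultimately show ?thesis
    by (simp only: class_sign_def mod_3_sign_def multiplicity_eq_prime_factor_count
        num_prime_factors_mod_eq_prime_factor_count minus_one_power_prime_factor_count_add
        flip: power_add)
qed

definition local_Lambda :: "nat \<Rightarrow> nat \<Rightarrow> real" where
  "local_Lambda p v =
    (if 3 < p \<and> p mod 20 \<in> {1, 3, 7, 9} then 1 + real v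
     else if p mod 20 \<in> {11, 13, 17, 19} then (1 + (-1) ^ v) / 2 else 1)"

lemma Lambda_eq_prod: "Lambda n = (\<Prod>p\<in>prime_factors n. local_Lambda p (multiplicity p n))"
proof -
  let ?f = "\<lambda>p. if 3 < p \<and> p mod 20 \<in> {1, 3, 7, 9} then 1 + real (multiplicity p n) else 1"
  let ?g = "\<lambda>p. if p mod 20 \<in> {11, 13, 17, 19} then (1 + (-1) ^ multiplicity p n) / 2 else (1 :: real)"
  have "Lambda n = (\<Prod>p\<in>prime_factors n. ?f p) * (\<Prod>p\<in>prime_factors n. ?g p)"
    unfolding Lambda_def by (simp only: prod.inter_filter finite_set_mset)
  also have "\<dots> = (\<Prod>p\<in>prime_factors n. ?f p * ?g p)"
    by (simp only: prod.distrib)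
  also have "\<dots> = (\<Prod>p\<in>prime_factors n. local_Lambda p (multiplicity p n))"
    by (intro prod.cong refl) (auto simp: local_Lambda_def)
  finally show ?thesis .
qed

lemma Lambda_prime_power_times:
  assumes p: "prime p" "\<not> p dvd m"
  shows "Lambda (p ^ v * m) = local_Lambda p v * Lambda m"
proof (cases "v = 0")
  case True
  then show ?thesis by (simp add: local_Lambda_def)
next
  case False
  have m: "m > 0" using p(2) by (intro gr0I) auto
  have notin: "p \<notin> prime_factors m"
    using p(2) by auto
  have "prime_factors (p ^ v * m) = insert p (prime_factors m)"
    using p(1) m False by (simp add: prime_factorization_mult prime_factorization_prime_power)
  moreover have "multiplicity p (p ^ v * m) = v"
    using p m by (simp add: multiplicity_prime_power_times not_dvd_imp_multiplicity_0)
  moreover have "multiplicity q (p ^ v * m) = multiplicity q m" if "q \<in> prime_factors m" for q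
    using p(1) m that notin by (auto simp: multiplicity_prime_power_times in_prime_factors_imp_prime)
  ultimately show ?thesis
    using notin by (simp add: Lambda_eq_prod)
qed

lemma Lambda_three_power_times:
  assumes "n > 0"
  shows "Lambda (3 ^ v * n) = Lambda n"
proof -
  obtain m where m: "n = 3 ^ multiplicity 3 n * m" "\<not> 3 dvd m"
    using multiplicity_decompose'[of n 3] assms by auto
  have "3 ^ v * n = 3 ^ (v + multiplicity 3 n) * m"
    using m(1) by (simp add: power_add mult.assoc)
  then have "Lambda (3 ^ v * n) = Lambda m"
    using Lambda_prime_power_times[OF _ m(2)] by (simp add: local_Lambda_def)
  moreover have "Lambda n = Lambda m"
    using Lambda_prime_power_times[OF _ m(2), of "multiplicity 3 n"] m(1)
    by (simp add: local_Lambda_def)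
  ultimately show ?thesis by simp
qed

definition mod_3_character :: "nat \<Rightarrow> real" where
  "mod_3_character n = (if n mod 3 = 0 then 0 else if n mod 3 = 1 then 1 else -1)"

lemma mod_3_character_mult: "mod_3_character (i * j) = mod_3_character i * mod_3_character j"
proof -
  have "i mod 3 \<in> {0, 1, 2}" "j mod 3 \<in> {0, 1, 2}" by auto
  moreover have "i * j mod 3 = (i mod 3) * (j mod 3) mod 3"
    by (simp add: mod_mult_eq)
  ultimately show ?thesis
    unfolding mod_3_character_def by (elim insertE emptyE) simp_all
qed

lemma mod_3_character_power: "mod_3_character (n ^ k) = mod_3_character n ^ k"
  by (induction k) (simp_all add: mod_3_character_mult, simp add: mod_3_character_def)

lemma local_Lambda_times_mod_3_character_power:
  assumes "prime p" "p \<noteq> 3"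
  shows "(-1) ^ (v * of_bool (mod_3_nonresidue_prime p)) * local_Lambda p v =
    mod_3_character p ^ v * local_Lambda p v"
proof -
  consider (two) "p = 2" | (five) "p = 5" | (coprime) "p \<notin> {2, 3, 5}"
    using assms(2) by auto
  then show ?thesis
  proof cases
    case coprime
    have "\<forall>r\<in>residues_coprime_60.
      r mod 20 \<in> {11, 13, 17, 19} \<or> r mod 3 = (if r \<in> {23, 29, 41, 47} then 2 else 1)"
      by (simp add: residues_coprime_60_def)
    from bspec[OF this prime_mod_60[OF assms(1) coprime]]
    have "p mod 20 \<in> {11, 13, 17, 19} \<or> p mod 3 = (if mod_3_nonresidue_prime p then 2 else 1)"
      using coprime by (simp add: mod_3_nonresidue_prime_def mod_mod_cancel)
    then show ?thesis
    proof
      assume "p mod 20 \<in> {11, 13, 17, 19}"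
      then have "local_Lambda p v = of_bool (even v)"
        by (auto simp: local_Lambda_def)
      moreover have "\<not> 3 dvd p"
        using assms primes_dvd_imp_eq[of 3 p] by auto
      then have "mod_3_character p * mod_3_character p = 1"
        by (simp add: mod_3_character_def dvd_eq_mod_eq_0)
      then have "mod_3_character p ^ v = 1" if "even v"
        using that by (auto elim!: evenE simp: power_mult power2_eq_square)
      ultimately show ?thesis
        by (simp add: minus_one_power_iff)
    next
      assume "p mod 3 = (if mod_3_nonresidue_prime p then 2 else 1)"
      then have "mod_3_character p = (if mod_3_nonresidue_prime p then -1 else 1)"
        by (simp add: mod_3_character_def split: if_splits)
      then show ?thesis by simp
    qed
  qed (simp_all add: mod_3_character_def local_Lambda_def mod_3_nonresidue_prime_def)
qed

lemma mod_3_sign_times_Lambda: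
  assumes "n > 0" "\<not> 3 dvd n"
  shows "mod_3_sign n * Lambda n = mod_3_character n * Lambda n"
  using assms
proof (induction n rule: prime_power_coprime_induct)
  case one
  then show ?case
    by (simp add: mod_3_sign_def prime_factor_count_def mod_3_character_def)
next
  case (prime_power_times p v m)
  show ?case
  proof (cases "v = 0")
    case True
    then show ?thesis
      using prime_power_times by simp
  next
    case False
    then have "p \<noteq> 3" "\<not> 3 dvd m" "m > 0"
      using prime_power_times.prems by (auto intro!: gr0I)
    then have "mod_3_sign (p ^ v * m) * Lambda (p ^ v * m) =
      ((-1) ^ (v * of_bool (mod_3_nonresidue_prime p)) * local_Lambda p v) * (mod_3_sign m * Lambda m)"
      using prime_power_times.hyps
      by (simp add: mod_3_sign_def prime_factor_count_prime_power_times power_add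
          Lambda_prime_power_times)
    also have "\<dots> = (mod_3_character p ^ v * local_Lambda p v) * (mod_3_character m * Lambda m)"
      unfolding local_Lambda_times_mod_3_character_power[OF \<open>prime p\<close> \<open>p \<noteq> 3\<close>]
      using prime_power_times.IH \<open>\<not> 3 dvd m\<close> by simp
    also have "\<dots> = mod_3_character (p ^ v * m) * Lambda (p ^ v * m)"
      using prime_power_times.hyps
      by (simp add: mod_3_character_mult mod_3_character_power Lambda_prime_power_times)
    finally show ?thesis .
  qed
qed

section \<open>The number of solutions of \<open>x\<^sup>2 + 5 y\<^sup>2 = n\<close>\<close>

text \<open>
  The solutions of \<open>x\<^sup>2 + 5 y\<^sup>2 = 2 n\<close> count the representations of \<open>n\<close> by \<open>2 x\<^sup>2 + 2 x y + 3 y\<^sup>2\<close>, the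
  nonprincipal form of discriminant \<open>-20\<close>. So \<open>\<epsilon> = 1\<close> and \<open>\<epsilon> = -1\<close> are the two characters of the class
  group, and \<open>\<epsilon>\<close> is the eigenvalue contributed by a nonprincipal prime.
\<close>

definition class_sum :: "real \<Rightarrow> nat \<Rightarrow> real" where
  "class_sum \<epsilon> n = real (card (norm_sols 5 (int n))) + \<epsilon> * real (card (norm_sols 5 (2 * int n)))"

lemma class_sum_ramified_times:
  assumes "\<epsilon> * \<epsilon> = 1" "p = 2 \<or> p = 5"
  shows "class_sum \<epsilon> (p * m) = \<epsilon> ^ of_bool (nonprincipal_prime p) * class_sum \<epsilon> m"
  using assms(2)
proof
  assume p: "p = 2"
  have "class_sum \<epsilon> (2 * m) =
    real (card (norm_sols 5 (2 * int m))) + \<epsilon> * real (card (norm_sols 5 (4 * int m)))"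
    by (simp add: class_sum_def)
  also have "\<dots> = (\<epsilon> * \<epsilon>) * real (card (norm_sols 5 (2 * int m))) + \<epsilon> * real (card (norm_sols 5 (int m)))"
    by (simp add: card_norm_sols_four_times assms(1))
  also have "\<dots> = \<epsilon> * class_sum \<epsilon> m"
    by (simp add: class_sum_def algebra_simps)
  finally show ?thesis
    by (simp add: p nonprincipal_prime_def)
next
  assume p: "p = 5"
  have "card (norm_sols 5 (5 * N)) = card (norm_sols 5 N)" for N
    by (simp add: card_norm_sols_ramified)
  moreover have "int (5 * m) = 5 * int m" "2 * (5 * int m) = 5 * (2 * int m)"
    by simp_all
  ultimately have "class_sum \<epsilon> (5 * m) = class_sum \<epsilon> m"
    by (simp only: class_sum_def)
  then show ?thesis
    by (simp add: p nonprincipal_prime_def)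
qed

lemma class_sum_ramified_power_times:
  assumes "\<epsilon> * \<epsilon> = 1" "p = 2 \<or> p = 5"
  shows "class_sum \<epsilon> (p ^ v * m) = \<epsilon> ^ (v * of_bool (nonprincipal_prime p)) * class_sum \<epsilon> m"
proof (induction v)
  case (Suc v)
  have "class_sum \<epsilon> (p ^ Suc v * m) = class_sum \<epsilon> (p * (p ^ v * m))"
    by (simp add: mult.assoc)
  also have "\<dots> = \<epsilon> ^ of_bool (nonprincipal_prime p) * (\<epsilon> ^ (v * of_bool (nonprincipal_prime p)) * class_sum \<epsilon> m)"
    by (simp only: class_sum_ramified_times[OF assms] Suc.IH)
  also have "\<dots> = \<epsilon> ^ (Suc v * of_bool (nonprincipal_prime p)) * class_sum \<epsilon> m"
    by (simp add: power_add)
  finally show ?case .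
qed simp

lemma prime_dvd_double_iff:
  fixes p :: nat
  assumes "prime p" "p \<noteq> 2"
  shows "p dvd 2 * m \<longleftrightarrow> p dvd m"
  using assms primes_dvd_imp_eq[of p 2] by (auto simp: prime_dvd_mult_iff)

lemma class_sum_inert_power_times:
  assumes p: "prime p" "p mod 20 \<in> {11, 13, 17, 19}" and m: "\<not> p dvd m"
  shows "class_sum \<epsilon> (p ^ v * m) = of_bool (even v) * class_sum \<epsilon> m"
proof -
  have "p \<noteq> 2" "p \<noteq> 5" "p mod 20 \<notin> {1, 3, 7, 9}"
    using p(2) by auto
  then have nonres: "\<not> QuadRes (int p) (- 5)"
    using QuadRes_minus_5_iff[OF p(1)] prime_gt_1_nat[OF p(1)] by simp
  have "\<not> int p dvd int m" "\<not> int p dvd 2 * int m"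
    using m prime_dvd_double_iff[OF p(1) \<open>p \<noteq> 2\<close>, of m] by (simp_all flip: int_dvd_int_iff)
  from this[THEN card_norm_sols_inert_power[OF _ nonres, rotated], of v] show ?thesis
    using p(1) by (simp add: class_sum_def mult.left_commute)
qed

lemma card_norm_sols_5_split_prime:
  fixes N :: int
  assumes p: "prime p" "p \<noteq> 2" "p mod 20 \<in> {1, 3, 7, 9}"
  shows "card (norm_sols 5 (int p * N)) + (if int p dvd N then card (norm_sols 5 (N div int p)) else 0) =
    2 * card (norm_sols 5 ((if nonprincipal_prime p then 2 else 1) * N))"
proof -
  obtain u v :: int where uv: "u\<^sup>2 + 5 * v\<^sup>2 = (if nonprincipal_prime p then 2 else 1) * int p"
    using split_prime_norm_5[OF p] .
  have "odd p" "\<not> p dvd 5"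
    using p primes_dvd_imp_eq[of p 5] primes_dvd_imp_eq[of 2 p] by auto
  then have "odd (int p)" "\<not> int p dvd 5"
    by (simp_all add: int_dvd_int_iff[of p 5, simplified])
  then show ?thesis
    using card_norm_sols_split_prime[OF _ _ _ _ uv] p(1) by simp
qed

lemma class_sum_split_times:
  assumes \<epsilon>: "\<epsilon> * \<epsilon> = 1" and p: "prime p" "p \<noteq> 2" "p mod 20 \<in> {1, 3, 7, 9}"
  shows "class_sum \<epsilon> (p * m) + (if p dvd m then class_sum \<epsilon> (m div p) else 0) =
    2 * \<epsilon> ^ of_bool (nonprincipal_prime p) * class_sum \<epsilon> m"
proof -
  define k :: nat where "k = (if nonprincipal_prime p then 2 else 1)"
  have int_k: "int k = (if nonprincipal_prime p then 2 else 1)"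
    by (simp add: k_def)
  let ?R = "\<lambda>N. real (card (norm_sols 5 N))"
  have split: "?R (p * N) + (if p dvd N then ?R (N div p) else 0) = 2 * ?R (k * N)" for N :: int
    using arg_cong[OF card_norm_sols_5_split_prime[OF p], of real N] unfolding int_k
    by (simp split: if_splits)
  have single: "?R (int (p * m)) + (if p dvd m then ?R (int (m div p)) else 0) = 2 * ?R (int (k * m))"
    using split[of "int m"] by (simp add: zdiv_int split: if_splits)
  have "int p dvd 2 * int m \<longleftrightarrow> p dvd m"
    using prime_dvd_double_iff[OF p(1,2), of m] by (simp flip: int_dvd_int_iff)
  then have double: "?R (2 * int (p * m)) + (if p dvd m then ?R (2 * int (m div p)) else 0) =
      2 * ?R (2 * int (k * m))"
    using split[of "2 * int m"]
    by (simp add: zdiv_int div_mult_swap mult.left_commute split: if_splits)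
  have "class_sum \<epsilon> (p * m) + (if p dvd m then class_sum \<epsilon> (m div p) else 0) =
    (?R (int (p * m)) + (if p dvd m then ?R (int (m div p)) else 0)) +
    \<epsilon> * (?R (2 * int (p * m)) + (if p dvd m then ?R (2 * int (m div p)) else 0))"
    by (simp add: class_sum_def distrib_left)
  also have "\<dots> = 2 * class_sum \<epsilon> (k * m)"
    unfolding single double by (simp add: class_sum_def distrib_left)
  also have "class_sum \<epsilon> (k * m) = \<epsilon> ^ of_bool (nonprincipal_prime p) * class_sum \<epsilon> m"
    using class_sum_ramified_times[OF \<epsilon>, of 2 m] by (auto simp: k_def nonprincipal_prime_def[of 2])
  finally show ?thesis
    by simp
qed

lemma class_sum_split_power_times:
  assumes \<epsilon>: "\<epsilon> * \<epsilon> = 1" and p: "prime p" "p \<noteq> 2" "p mod 20 \<in> {1, 3, 7, 9}" and m: "\<not> p dvd m"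
  shows "class_sum \<epsilon> (p ^ v * m) =
    \<epsilon> ^ (v * of_bool (nonprincipal_prime p)) * (1 + real v) * class_sum \<epsilon> m"
proof -
  define s where "s = \<epsilon> ^ of_bool (nonprincipal_prime p)"
  have s: "s * s = 1"
    using \<epsilon> by (simp add: s_def)
  have recursion: "class_sum \<epsilon> (p * l) + (if p dvd l then class_sum \<epsilon> (l div p) else 0) =
      2 * s * class_sum \<epsilon> l" for l
    using class_sum_split_times[OF \<epsilon> p] by (simp only: s_def)
  have "class_sum \<epsilon> (p ^ v * m) = s ^ v * (1 + real v) * class_sum \<epsilon> m"
  proof (induction v rule: induct_nat_012)
    case 0
    show ?case by simp
  next
    case 1
    show ?case
      using recursion[of m] m by simp
  next
    case (ge2 v)
    have "class_sum \<epsilon> (p ^ Suc (Suc v) * m) =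
      2 * s * class_sum \<epsilon> (p ^ Suc v * m) - class_sum \<epsilon> (p ^ v * m)"
      using recursion[of "p ^ Suc v * m"] p(1) by (simp add: mult.assoc)
    also have "\<dots> = (2 * (s * s) * (2 + real v) - (1 + real v)) * s ^ v * class_sum \<epsilon> m"
      unfolding ge2.IH by (simp add: algebra_simps)
    also have "\<dots> = (s * s) * s ^ v * (1 + real (Suc (Suc v))) * class_sum \<epsilon> m"
      by (simp add: s)
    finally show ?case
      by simp
  qed
  then show ?thesis
    by (simp only: s_def power_mult[symmetric] mult.commute[of v])
qed

lemma class_sum_prime_power_times:
  assumes \<epsilon>: "\<epsilon> * \<epsilon> = 1" and p: "prime p" and m: "\<not> p dvd m"
  shows "class_sum \<epsilon> (p ^ v * m) =
    \<epsilon> ^ (v * of_bool (nonprincipal_prime p)) * (1 + real (v * of_bool (p = 3))) * local_Lambda p v *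
    class_sum \<epsilon> m"
proof -
  consider (ramified) "p = 2 \<or> p = 5" | (split) "p \<noteq> 2" "p mod 20 \<in> {1, 3, 7, 9}"
    | (inert) "p mod 20 \<in> {11, 13, 17, 19}"
  proof (cases "p \<in> {2, 3, 5}")
    case False
    have "\<forall>r\<in>residues_coprime_60. r mod 20 \<in> {1, 3, 7, 9} \<union> {11, 13, 17, 19}"
      by (simp add: residues_coprime_60_def)
    from bspec[OF this prime_mod_60[OF p False]] show ?thesis
      using False that by (auto simp: mod_mod_cancel)
  qed (use that in auto)
  then show ?thesis
  proof cases
    case ramified
    then show ?thesis
      using class_sum_ramified_power_times[OF \<epsilon> ramified] by (auto simp: local_Lambda_def)
  next
    case split
    have "1 + real v = (1 + real (v * of_bool (p = 3))) * local_Lambda p v"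
      using split prime_gt_1_nat[OF p] by (auto simp: local_Lambda_def)
    then show ?thesis
      using class_sum_split_power_times[OF \<epsilon> p split m] by simp
  next
    case inert
    then have "\<not> nonprincipal_prime p" "p \<noteq> 3" "local_Lambda p v = of_bool (even v)"
      by (auto simp: nonprincipal_prime_def local_Lambda_def)
    then show ?thesis
      using class_sum_inert_power_times[OF p inert m] by simp
  qed
qed

lemma norm_sols_if_less:
  assumes "0 \<le> d" "N < d"
  shows "norm_sols d N = {x. x\<^sup>2 = N} \<times> {0}"
proof -
  have "y = 0" if "x\<^sup>2 + d * y\<^sup>2 = N" for x y
  proof (rule ccontr)
    assume "y \<noteq> 0"
    then have "y\<^sup>2 \<ge> 1"
      using zero_less_power2[of y] by linarith
    then have "d * 1 \<le> d * y\<^sup>2"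
      using assms(1) by (rule mult_left_mono)
    then show False
      using that assms(2) zero_le_power2[of x] by linarith
  qed
  then show ?thesis
    by (auto simp: norm_sols_def)
qed

lemma class_sum_1: "class_sum \<epsilon> 1 = 2"
proof -
  have "{x :: int. x\<^sup>2 = 1} = {1, -1}"
    by (auto simp: power2_eq_1_iff)
  moreover have "x\<^sup>2 \<noteq> 2" for x :: int
    using square_mod_5[of x] by auto
  ultimately show ?thesis
    by (simp add: class_sum_def norm_sols_if_less)
qed

lemma class_sum_eq:
  assumes "n > 0" and \<epsilon>: "\<epsilon> * \<epsilon> = 1"
  shows "class_sum \<epsilon> n =
    2 * \<epsilon> ^ prime_factor_count nonprincipal_prime n * (1 + real (multiplicity 3 n)) * Lambda n"
  using assms(1)
proof (induction n rule: prime_power_coprime_induct)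
  case one
  show ?case
    using class_sum_1 by (simp add: prime_factor_count_def Lambda_def)
next
  case (prime_power_times p v m)
  have m_pos: "m > 0"
    using prime_power_times.hyps(2) by (intro gr0I) auto
  let ?N = "prime_factor_count nonprincipal_prime"
  have "multiplicity 3 m = 0" if "p = 3"
    using that prime_power_times.hyps(2) by (simp add: not_dvd_imp_multiplicity_0)
  then have mult_3: "(1 + real (v * of_bool (p = 3))) * (1 + real (multiplicity 3 m)) =
    1 + real (multiplicity 3 (p ^ v * m))"
    using prime_power_times.hyps m_pos by (auto simp: multiplicity_prime_power_times)
  have "class_sum \<epsilon> (p ^ v * m) = 2 * \<epsilon> ^ (v * of_bool (nonprincipal_prime p) + ?N m) *
    ((1 + real (v * of_bool (p = 3))) * (1 + real (multiplicity 3 m))) * (local_Lambda p v * Lambda m)"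
    unfolding class_sum_prime_power_times[OF \<epsilon> prime_power_times.hyps] prime_power_times.IH power_add
    by (simp only: mult_ac)
  then show ?case
    using prime_power_times.hyps m_pos
    by (simp only: mult_3 Lambda_prime_power_times[OF prime_power_times.hyps]
        prime_factor_count_prime_power_times)
qed

lemma card_norm_sols_5:
  assumes "n > 0"
  shows "real (card (norm_sols 5 (int n))) =
      (1 + class_sign n) * (1 + real (multiplicity 3 n)) * Lambda n"
    and "real (card (norm_sols 5 (2 * int n))) =
      (1 - class_sign n) * (1 + real (multiplicity 3 n)) * Lambda n"
  using class_sum_eq[OF assms, of 1] class_sum_eq[OF assms, of "-1"]
  by (simp_all add: class_sum_def class_sign_def algebra_simps)

section \<open>Forms of discriminant \<open>-180\<close>\<close>

lemma form_reps_1_0_multiple_of_square: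
  assumes "q \<noteq> 0"
  shows "form_reps 1 0 (d * q\<^sup>2) n = card {(x, y) \<in> norm_sols d (int n). q dvd y}"
proof -
  have "bij_betw (\<lambda>(x, y). (x, q * y)) {(x, y). 1 * x\<^sup>2 + 0 * x * y + d * q\<^sup>2 * y\<^sup>2 = int n}
    {(x, y) \<in> norm_sols d (int n). q dvd y}"
    using assms by (intro bij_betw_byWitness[where f' = "\<lambda>(x, y). (x, y div q)"])
      (auto simp: power_mult_distrib mult.assoc elim!: dvdE)
  then show ?thesis
    unfolding form_reps_def by (rule bij_betw_same_card)
qed

lemma form_reps_0_square:
  assumes "q \<noteq> 0"
  shows "form_reps d 0 (q\<^sup>2) n = card {(x, y) \<in> norm_sols d (int n). q dvd x}"
proof -
  have "bij_betw (\<lambda>(x, y). (q * y, x)) {(x, y). d * x\<^sup>2 + 0 * x * y + q\<^sup>2 * y\<^sup>2 = int n}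
    {(x, y) \<in> norm_sols d (int n). q dvd x}"
    using assms by (intro bij_betw_byWitness[where f' = "\<lambda>(x, y). (y, x div q)"])
      (auto simp: power_mult_distrib add.commute elim!: dvdE)
  then show ?thesis
    unfolding form_reps_def by (rule bij_betw_same_card)
qed

lemma even_norm_parity:
  fixes d x y :: int
  assumes "odd d" "x\<^sup>2 + d * y\<^sup>2 = 2 * n"
  shows "even x \<longleftrightarrow> even y"
proof -
  have "even (x\<^sup>2 + d * y\<^sup>2)" by (simp add: assms(2))
  then show ?thesis using assms(1) by simp
qed

lemma form_reps_symmetric:
  assumes a: "2 * a = q\<^sup>2 + d" and b: "b = q\<^sup>2 - d" and q: "odd q"
  shows "form_reps a b a n = card {(x, y) \<in> norm_sols d (2 * int n). q dvd x}"
proof -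
  let ?F = "{(x, y). a * x\<^sup>2 + b * x * y + a * y\<^sup>2 = int n}"
    and ?S = "{(x, y) \<in> norm_sols d (2 * int n). q dvd x}"
  let ?f = "\<lambda>(x, y). (q * (x + y), x - y)"
    and ?g = "\<lambda>(x, y). ((x div q + y) div 2, (x div q - y) div 2)"
  have norm: "(q * (x + y))\<^sup>2 + d * (x - y)\<^sup>2 = 2 * (a * x\<^sup>2 + b * x * y + a * y\<^sup>2)" for x y
  proof -
    have "2 * (a * x\<^sup>2 + b * x * y + a * y\<^sup>2) = (2 * a) * (x\<^sup>2 + y\<^sup>2) + 2 * b * x * y"
      by (simp add: algebra_simps)
    then show ?thesis
      unfolding a b by (simp add: power2_eq_square algebra_simps)
  qed
  have "odd d"
    using q dvd_triv_left[of 2 a] unfolding a by simp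
  have "bij_betw ?f ?F ?S"
  proof (rule bij_betw_byWitness[where f' = ?g])
    have "\<exists>s t. x = q * (s + t) \<and> y = s - t \<and> (s, t) \<in> ?F"
      if x: "(x, y) \<in> norm_sols d (2 * int n)" "q dvd x" for x y
    proof -
      obtain z where z: "x = q * z" using x(2) by (rule dvdE)
      then have "even (z + y)"
        using even_norm_parity[OF \<open>odd d\<close>, of x y "int n"] x(1) q by simp
      then obtain s where s: "z + y = 2 * s" by (rule evenE)
      then have "x = q * (s + (s - y))" "y = s - (s - y)"
        using z by simp_all
      moreover have "(s, s - y) \<in> ?F"
        using x(1) norm[of s "s - y"] calculation by simp
      ultimately show ?thesis by blast
    qed
    then show "\<forall>z\<in>?S. ?f (?g z) = z" "?g ` ?S \<subseteq> ?F"
      using q by fastforce+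
  qed (use q norm in auto)
  then show ?thesis
    unfolding form_reps_def by (rule bij_betw_same_card)
qed

lemma form_reps_2_2:
  assumes c: "2 * c = d * q\<^sup>2 + 1"
  shows "form_reps 2 2 c n = card {(x, y) \<in> norm_sols d (2 * int n). q dvd y}"
proof -
  let ?F = "{(x, y). 2 * x\<^sup>2 + 2 * x * y + c * y\<^sup>2 = int n}"
    and ?S = "{(x, y) \<in> norm_sols d (2 * int n). q dvd y}"
  let ?f = "\<lambda>(x, y). (2 * x + y, q * y)"
    and ?g = "\<lambda>(x, y). ((x - y div q) div 2, y div q)"
  have norm: "(2 * x + y)\<^sup>2 + d * (q * y)\<^sup>2 = 2 * (2 * x\<^sup>2 + 2 * x * y + c * y\<^sup>2)" for x y
  proof -
    have "2 * (2 * x\<^sup>2 + 2 * x * y + c * y\<^sup>2) = 4 * x\<^sup>2 + 4 * x * y + (2 * c) * y\<^sup>2"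
      by (simp add: algebra_simps)
    then show ?thesis
      unfolding c by (simp add: power2_eq_square algebra_simps)
  qed
  have "odd (d * q\<^sup>2)"
    using dvd_triv_left[of 2 c] unfolding c by simp
  then have odd: "odd d" "odd q" by simp_all
  have "bij_betw ?f ?F ?S"
  proof (rule bij_betw_byWitness[where f' = ?g])
    have "\<exists>s t. x = 2 * s + t \<and> y = q * t \<and> (s, t) \<in> ?F"
      if x: "(x, y) \<in> norm_sols d (2 * int n)" "q dvd y" for x y
    proof -
      obtain t where t: "y = q * t" using x(2) by (rule dvdE)
      then have "even (x - t)"
        using even_norm_parity[OF odd(1), of x y "int n"] x(1) odd(2) by simp
      then obtain s where s: "x - t = 2 * s" by (rule evenE)
      then have "x = 2 * s + t" by simp
      moreover have "(s, t) \<in> ?F"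
        using x(1) norm[of s t] t calculation by simp
      ultimately show ?thesis using t by blast
    qed
    then show "\<forall>z\<in>?S. ?f (?g z) = z" "?g ` ?S \<subseteq> ?F"
      using odd by fastforce+
  qed (use odd norm in auto)
  then show ?thesis
    unfolding form_reps_def by (rule bij_betw_same_card)
qed

definition norm_sols_fst_3 :: "nat \<Rightarrow> (int \<times> int) set" where
  "norm_sols_fst_3 N = {(x, y) \<in> norm_sols 5 (int N). 3 dvd x}"

definition norm_sols_snd_3 :: "nat \<Rightarrow> (int \<times> int) set" where
  "norm_sols_snd_3 N = {(x, y) \<in> norm_sols 5 (int N). 3 dvd y}"

lemma form_reps_eq_card_norm_sols_3:
  "form_reps 1 0 45 n = card (norm_sols_snd_3 n)"
  "form_reps 5 0 9 n = card (norm_sols_fst_3 n)"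
  "form_reps 7 4 7 n = card (norm_sols_fst_3 (2 * n))"
  "form_reps 2 2 23 n = card (norm_sols_snd_3 (2 * n))"
  using form_reps_1_0_multiple_of_square[of 3 5 n] form_reps_0_square[of 3 5 n]
    form_reps_symmetric[of 7 3 5 4 n] form_reps_2_2[of 23 5 3 n]
  by (simp_all add: norm_sols_fst_3_def norm_sols_snd_3_def)

lemma norm_5_mod_3:
  assumes "(x, y) \<in> norm_sols 5 (int N)"
  shows "N mod 3 = 0 \<Longrightarrow> 3 dvd x \<longleftrightarrow> 3 dvd y"
    and "N mod 3 = 1 \<Longrightarrow> \<not> 3 dvd x \<and> 3 dvd y"
    and "N mod 3 = 2 \<Longrightarrow> 3 dvd x \<and> \<not> 3 dvd y"
proof -
  have square_mod_3: "z\<^sup>2 mod 3 = of_bool (\<not> 3 dvd z)" for z :: int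
  proof -
    have "z mod 3 \<in> {0, 1, 2}" by auto
    then have "(z mod 3)\<^sup>2 mod 3 = of_bool (z mod 3 \<noteq> 0)" by auto
    then show ?thesis by (simp add: power_mod dvd_eq_mod_eq_0)
  qed
  have "int N mod 3 = (x\<^sup>2 + 5 * y\<^sup>2) mod 3" using assms by simp
  also have "\<dots> = (x\<^sup>2 mod 3 + 5 * (y\<^sup>2 mod 3)) mod 3"
    by (intro mod_add_cong mod_mult_cong) simp_all
  finally have "int (N mod 3) = (of_bool (\<not> 3 dvd x) + 5 * of_bool (\<not> 3 dvd y)) mod 3"
    by (simp only: zmod_int square_mod_3 of_nat_numeral)
  then show "N mod 3 = 0 \<Longrightarrow> 3 dvd x \<longleftrightarrow> 3 dvd y"
    and "N mod 3 = 1 \<Longrightarrow> \<not> 3 dvd x \<and> 3 dvd y"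
    and "N mod 3 = 2 \<Longrightarrow> 3 dvd x \<and> \<not> 3 dvd y"
    by (cases "3 dvd x"; cases "3 dvd y"; simp)+
qed

lemma card_norm_sols_3_eq_mod_3_character:
  assumes "\<not> 3 dvd N"
  shows "real (card (norm_sols_snd_3 N)) =
      (1 + mod_3_character N) / 2 * real (card (norm_sols 5 (int N)))" (is ?snd)
    and "real (card (norm_sols_fst_3 N)) =
      (1 - mod_3_character N) / 2 * real (card (norm_sols 5 (int N)))" (is ?fst)
proof -
  have "N mod 3 = 1 \<or> N mod 3 = 2"
    using assms by presburger
  then have "norm_sols_snd_3 N = (if N mod 3 = 1 then norm_sols 5 (int N) else {}) \<and>
    norm_sols_fst_3 N = (if N mod 3 = 1 then {} else norm_sols 5 (int N)) \<and>
    mod_3_character N = (if N mod 3 = 1 then 1 else -1)"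
    by (rule disjE) (use norm_5_mod_3[of _ _ N] in
      \<open>auto simp: norm_sols_snd_3_def norm_sols_fst_3_def mod_3_character_def simp del: in_norm_sols\<close>)
  then show ?snd ?fst
    by simp_all
qed

lemma card_norm_sols_3_eq_div_9:
  assumes "3 dvd N"
  shows "card (norm_sols_snd_3 N) = (if 9 dvd N then card (norm_sols 5 (int (N div 9))) else 0)" (is ?snd)
    and "card (norm_sols_fst_3 N) = (if 9 dvd N then card (norm_sols 5 (int (N div 9))) else 0)" (is ?fst)
proof -
  have "norm_sols_snd_3 N = {(x, y) \<in> norm_sols 5 (int N). 3 dvd x \<and> 3 dvd y}"
    "norm_sols_fst_3 N = {(x, y) \<in> norm_sols 5 (int N). 3 dvd x \<and> 3 dvd y}"
    using norm_5_mod_3(1)[of _ _ N] assms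
    by (auto simp: norm_sols_snd_3_def norm_sols_fst_3_def simp del: in_norm_sols)
  moreover have "9 dvd int N \<longleftrightarrow> 9 dvd N"
    using int_dvd_int_iff[of 9 N] by simp
  ultimately show ?snd ?fst
    using card_norm_sols_common_divisor[of 3 5 "int N"] by (simp_all add: zdiv_int)
qed

lemma card_norm_sols_3_if_not_dvd:
  assumes "n > 0" "\<not> 3 dvd n"
  shows "real (card (norm_sols_snd_3 n)) =
      1/2 * (1 + class_sign n + mod_3_sign n + class_sign n * mod_3_sign n) * Lambda n" (is ?snd)
    and "real (card (norm_sols_fst_3 n)) =
      1/2 * (1 + class_sign n - mod_3_sign n - class_sign n * mod_3_sign n) * Lambda n" (is ?fst)
    and "real (card (norm_sols_fst_3 (2 * n))) =
      1/2 * (1 - class_sign n + mod_3_sign n - class_sign n * mod_3_sign n) * Lambda n" (is ?fst_double)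
    and "real (card (norm_sols_snd_3 (2 * n))) =
      1/2 * (1 - class_sign n - mod_3_sign n + class_sign n * mod_3_sign n) * Lambda n" (is ?snd_double)
proof -
  have "\<not> 3 dvd 2 * n"
    using assms(2) prime_dvd_double_iff[of 3 n] by simp
  have "mod_3_character 2 = -1"
    by (simp add: mod_3_character_def)
  then have character_double: "mod_3_character (2 * n) = - mod_3_character n"
    by (simp add: mod_3_character_mult)
  have "multiplicity 3 n = 0"
    using assms(2) by (simp add: not_dvd_imp_multiplicity_0)
  then have count_5: "real (card (norm_sols 5 (int n))) = (1 + class_sign n) * Lambda n"
    "real (card (norm_sols 5 (int (2 * n)))) = (1 - class_sign n) * Lambda n"
    using card_norm_sols_5[OF assms(1)] by simp_all
  have character_eq_sign: "Lambda n = 0 \<or> mod_3_character n = mod_3_sign n"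
    using mod_3_sign_times_Lambda[OF assms] by auto
  note count = card_norm_sols_3_eq_mod_3_character[OF assms(2)]
    card_norm_sols_3_eq_mod_3_character[OF \<open>\<not> 3 dvd 2 * n\<close>]
  show ?snd ?fst ?fst_double ?snd_double
    unfolding count count_5 character_double using character_eq_sign by (elim disjE; simp add: field_simps)+
qed

lemma card_norm_sols_5_div_9:
  assumes "n > 0" "3 dvd n"
  shows "real (if 9 dvd n then card (norm_sols 5 (int (n div 9))) else 0) =
      (real (multiplicity 3 n) - 1) * (1 + class_sign n) * Lambda n" (is ?single)
    and "real (if 9 dvd n then card (norm_sols 5 (2 * int (n div 9))) else 0) =
      (real (multiplicity 3 n) - 1) * (1 - class_sign n) * Lambda n" (is ?double)
proof -
  have "?single \<and> ?double"
  proof (cases "9 dvd n")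
    case True
    then obtain l where l: "n = 3\<^sup>2 * l" by (auto elim: dvdE)
    then have "l > 0" using assms(1) by simp
    then have "multiplicity 3 n = 2 + multiplicity 3 l" "class_sign n = class_sign l" "Lambda n = Lambda l"
      unfolding l class_sign_def
      using multiplicity_prime_power_times[of 3 3 l 2] Lambda_three_power_times[of l 2]
        prime_factor_count_prime_power_times[of 3 l nonprincipal_prime 2]
      by simp_all
    then show ?thesis
      using card_norm_sols_5[OF \<open>l > 0\<close>] True by (simp add: l)
  next
    case False
    have "multiplicity 3 n = 1"
    proof (rule multiplicity_eqI)
      show "3 ^ 1 dvd n" "\<not> 3 ^ Suc 1 dvd n"
        using assms(2) False by simp_all
    qed
    then show ?thesis using False by simp
  qed
  then show ?single ?double by simp_all
qed

lemma card_norm_sols_3_if_dvd: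
  assumes "n > 0" "3 dvd n"
  shows "real (card (norm_sols_snd_3 n)) =
      (real (multiplicity 3 n) - 1) * (1 + class_sign n) * Lambda n" (is ?snd)
    and "real (card (norm_sols_fst_3 n)) =
      (real (multiplicity 3 n) - 1) * (1 + class_sign n) * Lambda n" (is ?fst)
    and "real (card (norm_sols_fst_3 (2 * n))) =
      (real (multiplicity 3 n) - 1) * (1 - class_sign n) * Lambda n" (is ?fst_double)
    and "real (card (norm_sols_snd_3 (2 * n))) =
      (real (multiplicity 3 n) - 1) * (1 - class_sign n) * Lambda n" (is ?snd_double)
proof -
  have "3 dvd 2 * n"
    using assms(2) by simp
  moreover have "coprime 9 (2 :: nat)"
    by simp
  then have "9 dvd 2 * n \<longleftrightarrow> 9 dvd n"
    by (rule coprime_dvd_mult_right_iff)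
  moreover have "2 * n div 9 = 2 * (n div 9)" if "9 dvd n"
    using div_mult_swap[OF that] ..
  ultimately show ?snd ?fst ?fst_double ?snd_double
    using card_norm_sols_5_div_9[OF assms] card_norm_sols_3_eq_div_9[OF assms(2)]
      card_norm_sols_3_eq_div_9[OF \<open>3 dvd 2 * n\<close>]
    by (simp_all split: if_splits)
qed

theorem theorem4p3:
  fixes n a b c t1 t2 t3 :: nat
  assumes "n > 0"
    and "a = multiplicity 2 n"
    and "b = multiplicity 3 n"
    and "c = multiplicity 5 n"
    and "t1 = num_prime_factors_mod 20 {3, 7} n"
    and "t2 = num_prime_factors_mod 60 {23, 29, 41, 47} n"
    and "t3 = num_prime_factors_mod 60 {7, 29, 41, 43} n"
  shows "real (form_reps 1 0 45 n) =
           (if b = 0 then 1/2 * (1 + (-1) ^ (a + t1) + (-1) ^ (a + c + t2) + (-1) ^ (c + t3)) * Lambda n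
            else (real b - 1) * (1 + (-1) ^ (a + t1)) * Lambda n)
       \<and> real (form_reps 5 0 9 n) =
           (if b = 0 then 1/2 * (1 + (-1) ^ (a + t1) - (-1) ^ (a + c + t2) - (-1) ^ (c + t3)) * Lambda n
            else (real b - 1) * (1 + (-1) ^ (a + t1)) * Lambda n)
       \<and> real (form_reps 7 4 7 n) =
           (if b = 0 then 1/2 * (1 - (-1) ^ (a + t1) + (-1) ^ (a + c + t2) - (-1) ^ (c + t3)) * Lambda n
            else (real b - 1) * (1 - (-1) ^ (a + t1)) * Lambda n)
       \<and> real (form_reps 2 2 23 n) =
           (if b = 0 then 1/2 * (1 - (-1) ^ (a + t1) - (-1) ^ (a + c + t2) + (-1) ^ (c + t3)) * Lambda n
            else (real b - 1) * (1 - (-1) ^ (a + t1)) * Lambda n)"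
proof -
  have power_a_t1: "(-1) ^ (a + t1) = class_sign n"
    using assms minus_one_power_eq_class_sign by simp
  show ?thesis
  proof (cases "b = 0")
    case True
    then have not_dvd: "\<not> 3 dvd n"
      using assms(1,3) by (auto simp: multiplicity_eq_zero_iff)
    have power_a_c_t2: "(-1) ^ (a + c + t2) = mod_3_sign n"
      using assms minus_one_power_eq_mod_3_sign by simp
    have power_c_t3: "(-1) ^ (c + t3) = class_sign n * mod_3_sign n"
      using assms minus_one_power_eq_class_sign_times_mod_3_sign[OF not_dvd] by simp
    show ?thesis
      unfolding form_reps_eq_card_norm_sols_3 card_norm_sols_3_if_not_dvd[OF assms(1) not_dvd]
        power_a_t1 power_a_c_t2 power_c_t3
      using True by simp
  next
    case False
    then have "3 dvd n"
      using assms(3) not_dvd_imp_multiplicity_0[of 3 n] by auto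
    then show ?thesis
      using False unfolding form_reps_eq_card_norm_sols_3 power_a_t1
      by (simp add: card_norm_sols_3_if_dvd[OF assms(1)] flip: assms(3))
  qed
qed

end
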